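(* Let $\mathfrak g(D_{12})$ be the complex Lie algebra with basis $\{e_1,e_2,e_3\}$ and only non-zero brackets (up to skew-symmetry) $[e_1,e_3]=-e_1$, $[e_2,e_3]=e_2$, and let $\{e_1^*,e_2^*,e_3^*\}$ be the dual basis of $\mathfrak g(D_{12})^*$. Then the Lie algebra $\mathfrak g(D_{12})\ltimes_{\mathrm{ad}^*}\mathfrak g(D_{12})^*$ has basis $\{e_1,e_2,e_3,e_1^*,e_2^*,e_3^*\}$ with non-zero brackets (up to skew-symmetry) $$[e_1,e_3]=-e_1,\ [e_1,e_1^*]=e_3^*,\ [e_2,e_3]=e_2,\ [e_2,e_2^*]=-e_3^*,\ [e_3,e_1^*]=-e_1^*,\ [e_3,e_2^*]=e_2^*.$$ Moreover, for all complex parameters $n_{ij}$ subject to the stated restrictions, each of the following is a solution of the classical Yang–Baxter equation on this Lie algebra: - $r_1=(n_{31}e_1+n_{32}e_2)\otimes e_3^*-e_3^*\otimes(n_{31}e_1+n_{32}e_2)$; - $r_2=n_{21}e_1\otimes e_2^*+n_{31}e_1\otimes e_3^*-e_2^*\otimes n_{21}e_1-e_3^*\otimes n_{31}e_1$, $n_{21}\neq0$; - $r_3=n_{12}e_2\otimes e_1^*+n_{32}e_2\otimes e_3^*-e_1^*\otimes n_{12}e_2-e_3^*\otimes n_{32}e_2$, $n_{12}\neq0$; - $r_4=u\otimes e_2^*+v\otimes e_3^*-e_2^*\otimes u-e_3^*\otimes v$, where $u=n_{21}e_1-n_{33}e_2+n_{23}e_3$, $v=\frac{n_{21}n_{33}}{n_{23}}e_1-\frac{n_{33}^2}{n_{23}}e_2+n_{33}e_3$,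 $n_{23}\neq0$; - $r_5=u\otimes e_1^*+v\otimes e_3^*-e_1^*\otimes u-e_3^*\otimes v$, where $u=-n_{33}e_1+n_{12}e_2+n_{13}e_3$, $v=-\frac{n_{33}^2}{n_{13}}e_1+\frac{n_{12}n_{33}}{n_{13}}e_2+n_{33}e_3$, $n_{13}\neq0$.
   Context: For a Lie algebra $\mathfrak g$, the coadjoint representation $\mathrm{ad}^*:\mathfrak g\to\mathfrak{gl}(\mathfrak g^* )$ is $\langle\mathrm{ad}^*_x\xi,y\rangle=-\langle\xi,[x,y]\rangle$, and $\mathfrak g\ltimes_{\mathrm{ad}^*}\mathfrak g^*$ is $\mathfrak g\oplus\mathfrak g^*$ with bracket $[x_1+\xi_1,x_2+\xi_2]=[x_1,x_2]+\mathrm{ad}^*_{x_1}\xi_2-\mathrm{ad}^*_{x_2}\xi_1$. An element $r=\sum_i a_i\otimes b_i\in\mathfrak h\otimes\mathfrak h$ of a Lie algebra $\mathfrak h$ is a solution of the classical Yang–Baxter equation (CYBE) in $\mathfrak h$ if $[r_{12},r_{13}]+[r_{12},r_{23}]+[r_{13},r_{23}]=0$ in $U(\mathfrak h)^{\otimes 3}$, where $r_{12}=\sum_i a_i\otimes b_i\otimes1$, $r_{13}=\sum_i a_i\otimes1\otimes b_i$, $r_{23}=\sum_i1\otimes a_i\otimes b_i$ and $U(\mathfrak h)$ is the universal enveloping algebra. ($\mathfrak g(D_{12})$ is the commutator Lie algebra of the associative algebra $D_{12}$: $e_3\cdot e_1=e_1$, $e_2\cdot e_3=e_2$, $e_3\cdot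 e_3=e_3$, other products of basis elements zero.) *)

theory Defs
  imports Complex_Main "HOL-Library.Poly_Mapping" "HOL-Library.Product_Plus"
begin

section \<open>Complex vector spaces, algebras and Lie algebras\<close>

class scaleC =
  fixes scaleC :: "complex \<Rightarrow> 'a \<Rightarrow> 'a"  (infixr \<open>*\<^sub>C\<close> 75)

class complex_vector = scaleC + ab_group_add +
  assumes scaleC_add_right: "c *\<^sub>C (x + y) = c *\<^sub>C x + c *\<^sub>C y"
    and scaleC_add_left: "(c + d) *\<^sub>C x = c *\<^sub>C x + d *\<^sub>C x"
    and scaleC_scaleC: "c *\<^sub>C d *\<^sub>C x = (c * d) *\<^sub>C x"
    and scaleC_one: "1 *\<^sub>C x = x"

interpretation cvec: vector_space "scaleC :: complex \<Rightarrow> 'a::complex_vector \<Rightarrow> 'a"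
  by unfold_locales (simp_all add: scaleC_add_right scaleC_add_left scaleC_scaleC scaleC_one)

abbreviation clinear :: "('a::complex_vector \<Rightarrow> 'b::complex_vector) \<Rightarrow> bool"
  where "clinear \<equiv> Vector_Spaces.linear scaleC scaleC"

lemma clinearI:
  fixes f :: "'a::complex_vector \<Rightarrow> 'b::complex_vector"
  assumes "\<And>x y. f (x + y) = f x + f y" "\<And>c x. f (c *\<^sub>C x) = c *\<^sub>C f x"
  shows "clinear f"
  using assms by (simp add: Vector_Spaces.linear_iff cvec.vector_space_axioms)

lemma clinear_iff:
  "clinear f \<longleftrightarrow> (\<forall>x y. f (x + y) = f x + f y) \<and> (\<forall>c x. f (c *\<^sub>C x) = c *\<^sub>C f x)"
  for f :: "'a::complex_vector \<Rightarrow> 'b::complex_vector"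
  by (simp add: Vector_Spaces.linear_iff cvec.vector_space_axioms)

definition cbilinear :: "('a::complex_vector \<Rightarrow> 'b::complex_vector \<Rightarrow> 'c::complex_vector) \<Rightarrow> bool"
  where "cbilinear f \<longleftrightarrow> (\<forall>b. clinear (\<lambda>a. f a b)) \<and> (\<forall>a. clinear (f a))"

definition basis_list :: "'a::complex_vector list \<Rightarrow> bool"
  where "basis_list bs \<longleftrightarrow>
    distinct bs \<and> cvec.independent (set bs) \<and> cvec.span (set bs) = UNIV"

instantiation complex :: complex_vector
begin
definition scaleC_complex :: "complex \<Rightarrow> complex \<Rightarrow> complex"
  where "scaleC_complex = (*)"
instance by standard (simp_all add: scaleC_complex_def algebra_simps)
end

lemma scaleC_complex [simp]: "c *\<^sub>C z = c * z" for z :: complex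
  by (simp add: scaleC_complex_def)

lemma poly_mapping_induct [case_names single sum]:
  assumes "\<And>k v. P (Poly_Mapping.single k v)" "\<And>f g. P f \<Longrightarrow> P g \<Longrightarrow> P (f + g)"
  shows "P (p :: 'a \<Rightarrow>\<^sub>0 'b::monoid_add)"
proof (induction p rule: update_induct)
  case const
  then show ?case using assms(1) [of undefined 0] by simp
next
  case (update f a b)
  have "Poly_Mapping.update a b f = Poly_Mapping.single a b + f"
    using update(1)
    by (intro poly_mapping_eqI)
      (auto simp: lookup_update lookup_add lookup_single when_def in_keys_iff)
  then show ?case using assms update(3) by metis
qed

instantiation poly_mapping :: (type, complex_vector) complex_vector
begin
definition scaleC_poly_mapping :: "complex \<Rightarrow> ('a \<Rightarrow>\<^sub>0 'b) \<Rightarrow> ('a \<Rightarrow>\<^sub>0 'b)"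
  where "scaleC_poly_mapping c = Poly_Mapping.map (scaleC c)"

lemma lookup_scaleC [simp]: "Poly_Mapping.lookup (c *\<^sub>C p) k = c *\<^sub>C Poly_Mapping.lookup p k"
  for p :: "'a \<Rightarrow>\<^sub>0 'b"
  unfolding scaleC_poly_mapping_def by (simp add: Poly_Mapping.map.rep_eq when_def)

instance
  by standard
    (auto intro!: poly_mapping_eqI
      simp: lookup_add scaleC_add_right scaleC_add_left scaleC_scaleC scaleC_one)
end

text \<open>Associative unital algebras. The class \<open>ring_1\<close> is avoided because it would exclude
  the zero algebra.\<close>

class complex_algebra_1 = complex_vector + ring + monoid_mult +
  assumes mult_scaleC_left: "(c *\<^sub>C x) * y = c *\<^sub>C (x * y)"
    and mult_scaleC_right: "x * (c *\<^sub>C y) = c *\<^sub>C (x * y)"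

definition commutator :: "'a::ring \<Rightarrow> 'a \<Rightarrow> 'a"
  where "commutator x y = x * y - y * x"

class complex_lie_algebra = complex_vector +
  fixes lie_bracket :: "'a \<Rightarrow> 'a \<Rightarrow> 'a"
  assumes lie_add_left: "lie_bracket (x + y) z = lie_bracket x z + lie_bracket y z"
    and lie_add_right: "lie_bracket x (y + z) = lie_bracket x y + lie_bracket x z"
    and lie_scaleC_left: "lie_bracket (c *\<^sub>C x) y = c *\<^sub>C lie_bracket x y"
    and lie_scaleC_right: "lie_bracket x (c *\<^sub>C y) = c *\<^sub>C lie_bracket x y"
    and lie_self: "lie_bracket x x = 0"
    and lie_jacobi:
      "lie_bracket x (lie_bracket y z) + lie_bracket y (lie_bracket z x)
        + lie_bracket z (lie_bracket x y) = 0"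

lemma lie_skew: "lie_bracket y x = - lie_bracket x y"
  for x y :: "'a::complex_lie_algebra"
proof -
  have "lie_bracket x y + lie_bracket y x = 0"
    using lie_self [of "x + y", unfolded lie_add_left lie_add_right] by (simp add: lie_self add.commute)
  then show ?thesis
    by (metis minus_unique)
qed


section \<open>Dual space and coadjoint semidirect product\<close>

typedef (overloaded) 'a dual = "{f :: 'a::complex_vector \<Rightarrow> complex. clinear f}"
  morphisms dual_apply Abs_dual
  by (rule exI [of _ "\<lambda>_. 0"]) (simp add: clinear_iff)

setup_lifting type_definition_dual

instantiation dual :: (complex_vector) complex_vector
begin
lift_definition zero_dual :: "'a dual" is "\<lambda>_. 0" by (simp add: clinear_iff)
lift_definition plus_dual :: "'a dual \<Rightarrow> 'a dual \<Rightarrow> 'a dual" is "\<lambda>f g x. f x + g x"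
  by (simp add: clinear_iff algebra_simps)
lift_definition minus_dual :: "'a dual \<Rightarrow> 'a dual \<Rightarrow> 'a dual" is "\<lambda>f g x. f x - g x"
  by (simp add: clinear_iff algebra_simps)
lift_definition uminus_dual :: "'a dual \<Rightarrow> 'a dual" is "\<lambda>f x. - f x"
  by (simp add: clinear_iff algebra_simps)
lift_definition scaleC_dual :: "complex \<Rightarrow> 'a dual \<Rightarrow> 'a dual" is "\<lambda>c f x. c * f x"
  by (simp add: clinear_iff algebra_simps)
instance by standard (transfer; simp add: fun_eq_iff algebra_simps)+
end

definition dual_basis_of :: "'a::complex_vector list \<Rightarrow> 'a dual list \<Rightarrow> bool"
  where "dual_basis_of bs ds \<longleftrightarrow> length ds = length bs \<and>
    (\<forall>i < length bs. \<forall>j < length bs. dual_apply (ds ! i) (bs ! j) = (if i = j then 1 else 0))"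

lemma dual_basis_exists:
  assumes "basis_list bs"
  shows "\<exists>ds. dual_basis_of bs ds"
proof -
  define R where "R = cvec.representation (set bs)"
  have ind: "cvec.independent (set bs)" and span: "cvec.span (set bs) = UNIV" and "distinct bs"
    using assms by (auto simp: basis_list_def)
  have "clinear (\<lambda>x. R x b)" for b
    using ind span
    by (simp add: clinear_iff R_def cvec.representation_add cvec.representation_scale)
  then have "dual_apply (Abs_dual (\<lambda>x. R x b)) = (\<lambda>x. R x b)" for b
    by (simp add: Abs_dual_inverse)
  then have "dual_basis_of bs (map (\<lambda>b. Abs_dual (\<lambda>x. R x b)) bs)"
    using \<open>distinct bs\<close> ind
    by (auto simp: dual_basis_of_def R_def cvec.representation_basis nth_eq_iff_index_eq)
  then show ?thesis ..
qed

lift_definition coad :: "'a::complex_lie_algebra \<Rightarrow> 'a dual \<Rightarrow> 'a dual"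
  is "\<lambda>x \<xi> y. - \<xi> (lie_bracket x y)"
  by (simp add: clinear_iff lie_add_right lie_scaleC_right)

lemma coad_linear:
  "coad (x + y) \<xi> = coad x \<xi> + coad y \<xi>" "coad (c *\<^sub>C x) \<xi> = c *\<^sub>C coad x \<xi>"
  "coad x (\<xi> + \<eta>) = coad x \<xi> + coad x \<eta>" "coad x (c *\<^sub>C \<xi>) = c *\<^sub>C coad x \<xi>"
  by (transfer; simp add: fun_eq_iff clinear_iff lie_add_left lie_scaleC_left)+

lemma coad_diff: "coad x (\<xi> - \<eta>) = coad x \<xi> - coad x \<eta>"
  using coad_linear(3) [of x "\<xi> - \<eta>" \<eta>] by (simp add: eq_diff_eq)

lemma coad_lie: "coad (lie_bracket x y) \<xi> = coad x (coad y \<xi>) - coad y (coad x \<xi>)"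
proof (transfer, rule ext)
  fix x y z :: 'a and \<xi> :: "'a \<Rightarrow> complex"
  assume "clinear \<xi>"
  then interpret \<xi>: Vector_Spaces.linear scaleC scaleC \<xi> .
  have "lie_bracket (lie_bracket x y) z = - lie_bracket z (lie_bracket x y)"
    by (rule lie_skew)
  also have "\<dots> = lie_bracket x (lie_bracket y z) + lie_bracket y (lie_bracket z x)"
    using lie_jacobi [of x y z] by (simp add: minus_unique add.commute)
  also have "lie_bracket y (lie_bracket z x) = - lie_bracket y (lie_bracket x z)"
    using lie_scaleC_right [of y "- 1" "lie_bracket x z"] by (simp add: lie_skew [of z x])
  finally have "\<xi> (lie_bracket (lie_bracket x y) z)
      = \<xi> (lie_bracket x (lie_bracket y z)) - \<xi> (lie_bracket y (lie_bracket x z))"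
    by (simp add: \<xi>.diff)
  then show "- \<xi> (lie_bracket (lie_bracket x y) z)
      = - (- \<xi> (lie_bracket y (lie_bracket x z))) - - (- \<xi> (lie_bracket x (lie_bracket y z)))"
    by simp
qed

lifting_forget dual.lifting

text \<open>The coadjoint semidirect product; a type of its own because pairs would suggest the
  direct product of Lie algebras.\<close>

typedef (overloaded) 'a coad_semidirect = "UNIV :: ('a::complex_lie_algebra \<times> 'a dual) set"
  by simp

setup_lifting type_definition_coad_semidirect

lift_definition in_alg :: "'a::complex_lie_algebra \<Rightarrow> 'a coad_semidirect" is "\<lambda>x. (x, 0)" .
lift_definition in_dual :: "'a::complex_lie_algebra dual \<Rightarrow> 'a coad_semidirect" is "\<lambda>\<xi>. (0, \<xi>)" .

instantiation coad_semidirect :: (complex_lie_algebra) complex_lie_algebra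
begin
lift_definition zero_coad_semidirect :: "'a coad_semidirect" is 0 .
lift_definition plus_coad_semidirect ::
  "'a coad_semidirect \<Rightarrow> 'a coad_semidirect \<Rightarrow> 'a coad_semidirect" is "(+)" .
lift_definition minus_coad_semidirect ::
  "'a coad_semidirect \<Rightarrow> 'a coad_semidirect \<Rightarrow> 'a coad_semidirect" is "(-)" .
lift_definition uminus_coad_semidirect :: "'a coad_semidirect \<Rightarrow> 'a coad_semidirect" is uminus .
lift_definition scaleC_coad_semidirect :: "complex \<Rightarrow> 'a coad_semidirect \<Rightarrow> 'a coad_semidirect"
  is "\<lambda>c (x, \<xi>). (c *\<^sub>C x, c *\<^sub>C \<xi>)" .
lift_definition lie_bracket_coad_semidirect ::
  "'a coad_semidirect \<Rightarrow> 'a coad_semidirect \<Rightarrow> 'a coad_semidirect"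
  is "\<lambda>(x1, \<xi>1) (x2, \<xi>2). (lie_bracket x1 x2, coad x1 \<xi>2 - coad x2 \<xi>1)" .
instance
proof
  fix x y z :: "'a coad_semidirect" and c d :: complex
  show "x + y + z = x + (y + z)" by transfer (rule add.assoc)
  show "x + y = y + x" by transfer (rule add.commute)
  show "0 + x = x" by transfer simp
  show "- x + x = 0" by transfer simp
  show "x - y = x + - y" by transfer simp
  show "c *\<^sub>C (x + y) = c *\<^sub>C x + c *\<^sub>C y"
    by transfer (clarsimp simp: scaleC_add_right)
  show "(c + d) *\<^sub>C x = c *\<^sub>C x + d *\<^sub>C x"
    by transfer (clarsimp simp: scaleC_add_left)
  show "c *\<^sub>C d *\<^sub>C x = (c * d) *\<^sub>C x"
    by transfer (clarsimp simp: scaleC_scaleC)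
  show "1 *\<^sub>C x = x"
    by transfer (clarsimp simp: scaleC_one)
  show "lie_bracket (x + y) z = lie_bracket x z + lie_bracket y z"
    by transfer (clarsimp simp: lie_add_left coad_linear)
  show "lie_bracket x (y + z) = lie_bracket x y + lie_bracket x z"
    by transfer (clarsimp simp: lie_add_right coad_linear)
  show "lie_bracket (c *\<^sub>C x) y = c *\<^sub>C lie_bracket x y"
    by transfer (clarsimp simp: lie_scaleC_left coad_linear cvec.scale_right_diff_distrib)
  show "lie_bracket x (c *\<^sub>C y) = c *\<^sub>C lie_bracket x y"
    by transfer (clarsimp simp: lie_scaleC_right coad_linear cvec.scale_right_diff_distrib)
  show "lie_bracket x x = 0"
    by transfer (clarsimp simp: lie_self zero_prod_def)
  show "lie_bracket x (lie_bracket y z) + lie_bracket y (lie_bracket z x)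
      + lie_bracket z (lie_bracket x y) = 0"
    by transfer (clarsimp simp: lie_jacobi coad_diff coad_lie zero_prod_def)
qed
end


section \<open>Universal enveloping algebra\<close>

text \<open>Words form a monoid under concatenation, so that \<open>'a word \<Rightarrow>\<^sub>0 complex\<close>
  with the convolution product of the library is the free associative algebra on the set of
  all elements of \<open>'a\<close>.\<close>

datatype 'a word = Word (letters: "'a list")

instantiation word :: (type) monoid_add
begin
definition zero_word :: "'a word" where "0 = Word []"
definition plus_word :: "'a word \<Rightarrow> 'a word \<Rightarrow> 'a word"
  where "v + w = Word (letters v @ letters w)"
instance by standard (simp_all add: zero_word_def plus_word_def)
end

type_synonym 'a free_alg = "'a word \<Rightarrow>\<^sub>0 complex"

definition gen :: "'a \<Rightarrow> 'a free_alg"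
  where "gen x = Poly_Mapping.single (Word [x]) 1"

lemma free_alg_scaleC_mult:
  fixes p q :: "'a free_alg"
  shows "(c *\<^sub>C p) * q = c *\<^sub>C (p * q)" "p * (c *\<^sub>C q) = c *\<^sub>C (p * q)"
proof -
  have sc: "c *\<^sub>C r = Poly_Mapping.single 0 c * r" for r :: "'a free_alg"
    unfolding scaleC_poly_mapping_def scaleC_complex_def by (rule mult_map_scale_conv_mult)
  have comm: "r * Poly_Mapping.single 0 c = Poly_Mapping.single 0 c * r" for r :: "'a free_alg"
  proof (induction r rule: poly_mapping_induct)
    case (single k v)
    then show ?case by (simp add: mult_single mult.commute)
  next
    case (sum f g)
    then show ?case by (simp add: algebra_simps)
  qed
  show "(c *\<^sub>C p) * q = c *\<^sub>C (p * q)"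
    by (simp only: sc mult.assoc)
  show "p * (c *\<^sub>C q) = c *\<^sub>C (p * q)"
    by (simp only: sc mult.assoc [symmetric] comm)
qed

inductive_set two_sided_ideal :: "'a::ring set \<Rightarrow> 'a set" for S
  where
    base: "x \<in> S \<Longrightarrow> x \<in> two_sided_ideal S"
  | zero: "0 \<in> two_sided_ideal S"
  | diff: "\<lbrakk>x \<in> two_sided_ideal S; y \<in> two_sided_ideal S\<rbrakk> \<Longrightarrow> x - y \<in> two_sided_ideal S"
  | mult_left: "x \<in> two_sided_ideal S \<Longrightarrow> r * x \<in> two_sided_ideal S"
  | mult_right: "x \<in> two_sided_ideal S \<Longrightarrow> x * r \<in> two_sided_ideal S"

text \<open>The first two families of relations cut the free algebra down to the tensor algebra
  of \<^typ>\<open>'a\<close>; the third one is \<open>x \<otimes> y - y \<otimes> x - [x, y]\<close>.\<close>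

definition uea_relations :: "'a::complex_lie_algebra free_alg set"
  where "uea_relations =
    {gen (x + y) - (gen x + gen y) | x y. True} \<union>
    {gen (c *\<^sub>C x) - c *\<^sub>C gen x | c x. True} \<union>
    {gen x * gen y - gen y * gen x - gen (lie_bracket x y) | x y. True}"

definition uea_rel :: "'a::complex_lie_algebra free_alg \<Rightarrow> 'a free_alg \<Rightarrow> bool"
  where "uea_rel p q \<longleftrightarrow> p - q \<in> two_sided_ideal uea_relations"

lemma ideal_uminus: "x \<in> two_sided_ideal S \<Longrightarrow> - x \<in> two_sided_ideal S"
  using two_sided_ideal.diff [OF two_sided_ideal.zero, of x S] by simp

lemma ideal_add:
  "x \<in> two_sided_ideal S \<Longrightarrow> y \<in> two_sided_ideal S \<Longrightarrow> x + y \<in> two_sided_ideal S"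
  using two_sided_ideal.diff [of x S "- y"] ideal_uminus [of y S] by simp

quotient_type (overloaded) 'a uea = "'a::complex_lie_algebra free_alg" / uea_rel
proof (rule equivpI)
  show "reflp uea_rel"
    by (simp add: reflp_def uea_rel_def two_sided_ideal.zero)
  show "symp uea_rel"
    unfolding symp_def uea_rel_def by (metis ideal_uminus minus_diff_eq)
  show "transp uea_rel"
  proof (rule transpI)
    fix p q r
    assume "uea_rel p q" "uea_rel q r"
    then have "(p - q) + (q - r) \<in> two_sided_ideal uea_relations"
      unfolding uea_rel_def by (rule ideal_add)
    then show "uea_rel p r" by (simp add: uea_rel_def)
  qed
qed

instantiation uea :: (complex_lie_algebra) complex_algebra_1
begin
lift_definition zero_uea :: "'a uea" is 0 .
lift_definition one_uea :: "'a uea" is 1 .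
lift_definition plus_uea :: "'a uea \<Rightarrow> 'a uea \<Rightarrow> 'a uea" is "(+)"
proof -
  fix p p' q q' :: "'a free_alg"
  assume "uea_rel p p'" "uea_rel q q'"
  then have "(p - p') + (q - q') \<in> two_sided_ideal uea_relations"
    unfolding uea_rel_def by (rule ideal_add)
  then show "uea_rel (p + q) (p' + q')" by (simp add: uea_rel_def algebra_simps)
qed
lift_definition uminus_uea :: "'a uea \<Rightarrow> 'a uea" is uminus
proof -
  fix p q :: "'a free_alg"
  assume "uea_rel p q"
  then have "- (p - q) \<in> two_sided_ideal uea_relations"
    unfolding uea_rel_def by (rule ideal_uminus)
  then show "uea_rel (- p) (- q)" by (simp add: uea_rel_def)
qed
lift_definition minus_uea :: "'a uea \<Rightarrow> 'a uea \<Rightarrow> 'a uea" is "(-)"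
proof -
  fix p p' q q' :: "'a free_alg"
  assume "uea_rel p p'" "uea_rel q q'"
  then have "(p - p') - (q - q') \<in> two_sided_ideal uea_relations"
    unfolding uea_rel_def by (rule two_sided_ideal.diff)
  then show "uea_rel (p - q) (p' - q')" by (simp add: uea_rel_def algebra_simps)
qed
lift_definition times_uea :: "'a uea \<Rightarrow> 'a uea \<Rightarrow> 'a uea" is "(*)"
proof -
  fix p p' q q' :: "'a free_alg"
  assume "uea_rel p p'" "uea_rel q q'"
  then have "(p - p') * q + p' * (q - q') \<in> two_sided_ideal uea_relations"
    unfolding uea_rel_def
    by (intro ideal_add two_sided_ideal.mult_left two_sided_ideal.mult_right)
  then show "uea_rel (p * q) (p' * q')"
    by (simp add: uea_rel_def algebra_simps)
qed
lift_definition scaleC_uea :: "complex \<Rightarrow> 'a uea \<Rightarrow> 'a uea" is scaleC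
proof -
  fix c and p q :: "'a free_alg"
  assume "uea_rel p q"
  then have "(c *\<^sub>C 1) * (p - q) \<in> two_sided_ideal uea_relations"
    unfolding uea_rel_def by (rule two_sided_ideal.mult_left)
  then show "uea_rel (c *\<^sub>C p) (c *\<^sub>C q)"
    by (simp add: uea_rel_def free_alg_scaleC_mult cvec.scale_right_diff_distrib)
qed
instance
proof
  have eq: "uea_rel p q" if "p = q" for p q :: "'a free_alg"
    using that by (simp add: uea_rel_def two_sided_ideal.zero)
  fix a b c :: "'a uea" and s t :: complex
  show "a + b + c = a + (b + c)" by transfer (rule eq, simp add: add.assoc)
  show "a + b = b + a" by transfer (rule eq, simp add: add.commute)
  show "0 + a = a" by transfer (rule eq, simp)
  show "- a + a = 0" by transfer (rule eq, simp)
  show "a - b = a + - b" by transfer (rule eq, simp)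
  show "a * b * c = a * (b * c)" by transfer (rule eq, simp add: mult.assoc)
  show "1 * a = a" by transfer (rule eq, simp)
  show "a * 1 = a" by transfer (rule eq, simp)
  show "(a + b) * c = a * c + b * c" by transfer (rule eq, simp add: algebra_simps)
  show "a * (b + c) = a * b + a * c" by transfer (rule eq, simp add: algebra_simps)
  show "s *\<^sub>C (a + b) = s *\<^sub>C a + s *\<^sub>C b" by transfer (rule eq, rule scaleC_add_right)
  show "(s + t) *\<^sub>C a = s *\<^sub>C a + t *\<^sub>C a" by transfer (rule eq, rule scaleC_add_left)
  show "s *\<^sub>C t *\<^sub>C a = (s * t) *\<^sub>C a" by transfer (rule eq, rule scaleC_scaleC)
  show "1 *\<^sub>C a = a" by transfer (rule eq, rule scaleC_one)
  show "(s *\<^sub>C a) * b = s *\<^sub>C (a * b)" by transfer (rule eq, rule free_alg_scaleC_mult)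
  show "a * (s *\<^sub>C b) = s *\<^sub>C (a * b)" by transfer (rule eq, rule free_alg_scaleC_mult)
qed
end

lift_definition uea_incl :: "'a::complex_lie_algebra \<Rightarrow> 'a uea" is gen .

lemma uea_incl_add: "uea_incl (x + y) = uea_incl x + uea_incl y"
  by transfer (auto simp: uea_rel_def uea_relations_def intro!: two_sided_ideal.base)

lemma uea_incl_scaleC: "uea_incl (c *\<^sub>C x) = c *\<^sub>C uea_incl x"
  by transfer (auto simp: uea_rel_def uea_relations_def intro!: two_sided_ideal.base)

lemma uea_incl_lie: "commutator (uea_incl x) (uea_incl y) = uea_incl (lie_bracket x y)"
  unfolding commutator_def
  by transfer (auto simp: uea_rel_def uea_relations_def intro!: two_sided_ideal.base)


section \<open>Tensor products\<close>

definition tensor_relations :: "('a::complex_vector \<times> 'b::complex_vector \<Rightarrow>\<^sub>0 complex) set"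
  where "tensor_relations =
    (let \<delta> = \<lambda>a b. Poly_Mapping.single (a, b) 1 in
      {\<delta> (a + a') b - (\<delta> a b + \<delta> a' b) | a a' b. True} \<union>
      {\<delta> a (b + b') - (\<delta> a b + \<delta> a b') | a b b'. True} \<union>
      {\<delta> (c *\<^sub>C a) b - c *\<^sub>C \<delta> a b | a b c. True} \<union>
      {\<delta> a (c *\<^sub>C b) - c *\<^sub>C \<delta> a b | a b c. True})"

definition tensor_rel ::
  "('a::complex_vector \<times> 'b::complex_vector \<Rightarrow>\<^sub>0 complex) \<Rightarrow> ('a \<times> 'b \<Rightarrow>\<^sub>0 complex) \<Rightarrow> bool"
  where "tensor_rel p q \<longleftrightarrow> p - q \<in> cvec.span tensor_relations"

quotient_type (overloaded) ('a, 'b) tensor =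
  "'a::complex_vector \<times> 'b::complex_vector \<Rightarrow>\<^sub>0 complex" / tensor_rel
proof (rule equivpI)
  show "reflp tensor_rel"
    by (simp add: reflp_def tensor_rel_def cvec.span_zero)
  show "symp tensor_rel"
    unfolding symp_def tensor_rel_def by (metis cvec.span_neg minus_diff_eq)
  show "transp tensor_rel"
  proof (rule transpI)
    fix p q r
    assume "tensor_rel p q" "tensor_rel q r"
    then have "(p - q) + (q - r) \<in> cvec.span tensor_relations"
      unfolding tensor_rel_def by (rule cvec.span_add)
    then show "tensor_rel p r" by (simp add: tensor_rel_def)
  qed
qed

instantiation tensor :: (complex_vector, complex_vector) complex_vector
begin
lift_definition zero_tensor :: "('a, 'b) tensor" is 0 .
lift_definition plus_tensor :: "('a, 'b) tensor \<Rightarrow> ('a, 'b) tensor \<Rightarrow> ('a, 'b) tensor" is "(+)"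
proof -
  fix p p' q q' :: "'a \<times> 'b \<Rightarrow>\<^sub>0 complex"
  assume "tensor_rel p p'" "tensor_rel q q'"
  then have "(p - p') + (q - q') \<in> cvec.span tensor_relations"
    unfolding tensor_rel_def by (rule cvec.span_add)
  then show "tensor_rel (p + q) (p' + q')" by (simp add: tensor_rel_def algebra_simps)
qed
lift_definition uminus_tensor :: "('a, 'b) tensor \<Rightarrow> ('a, 'b) tensor" is uminus
proof -
  fix p q :: "'a \<times> 'b \<Rightarrow>\<^sub>0 complex"
  assume "tensor_rel p q"
  then have "- (p - q) \<in> cvec.span tensor_relations"
    unfolding tensor_rel_def by (rule cvec.span_neg)
  then show "tensor_rel (- p) (- q)" by (simp add: tensor_rel_def)
qed
lift_definition minus_tensor :: "('a, 'b) tensor \<Rightarrow> ('a, 'b) tensor \<Rightarrow> ('a, 'b) tensor" is "(-)"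
proof -
  fix p p' q q' :: "'a \<times> 'b \<Rightarrow>\<^sub>0 complex"
  assume "tensor_rel p p'" "tensor_rel q q'"
  then have "(p - p') - (q - q') \<in> cvec.span tensor_relations"
    unfolding tensor_rel_def by (rule cvec.span_diff)
  then show "tensor_rel (p - q) (p' - q')" by (simp add: tensor_rel_def algebra_simps)
qed
lift_definition scaleC_tensor :: "complex \<Rightarrow> ('a, 'b) tensor \<Rightarrow> ('a, 'b) tensor" is scaleC
  unfolding tensor_rel_def by (metis cvec.span_scale cvec.scale_right_diff_distrib)
instance
proof
  have eq: "tensor_rel p q" if "p = q" for p q :: "'a \<times> 'b \<Rightarrow>\<^sub>0 complex"
    using that by (simp add: tensor_rel_def cvec.span_zero)
  fix a b c :: "('a, 'b) tensor" and s t :: complex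
  show "a + b + c = a + (b + c)" by transfer (rule eq, simp add: add.assoc)
  show "a + b = b + a" by transfer (rule eq, simp add: add.commute)
  show "0 + a = a" by transfer (rule eq, simp)
  show "- a + a = 0" by transfer (rule eq, simp)
  show "a - b = a + - b" by transfer (rule eq, simp)
  show "s *\<^sub>C (a + b) = s *\<^sub>C a + s *\<^sub>C b" by transfer (rule eq, rule scaleC_add_right)
  show "(s + t) *\<^sub>C a = s *\<^sub>C a + t *\<^sub>C a" by transfer (rule eq, rule scaleC_add_left)
  show "s *\<^sub>C t *\<^sub>C a = (s * t) *\<^sub>C a" by transfer (rule eq, rule scaleC_scaleC)
  show "1 *\<^sub>C a = a" by transfer (rule eq, rule scaleC_one)
qed
end

lift_definition pure_tensor :: "'a::complex_vector \<Rightarrow> 'b::complex_vector \<Rightarrow> ('a, 'b) tensor"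
  (infixr \<open>\<otimes>\<close> 70) is "\<lambda>a b. Poly_Mapping.single (a, b) 1" .

lemma pure_tensor_linear:
  fixes a a' :: "'a::complex_vector" and b b' :: "'b::complex_vector"
  shows "(a + a') \<otimes> b = a \<otimes> b + a' \<otimes> b" "a \<otimes> (b + b') = a \<otimes> b + a \<otimes> b'"
    "(c *\<^sub>C a) \<otimes> b = c *\<^sub>C (a \<otimes> b)" "a \<otimes> (c *\<^sub>C b) = c *\<^sub>C (a \<otimes> b)"
  by (transfer, unfold tensor_rel_def, rule cvec.span_base, unfold tensor_relations_def Let_def,
      blast)+

lemma tensor_induct [case_names pure add]:
  fixes t :: "('a::complex_vector, 'b::complex_vector) tensor"
  assumes pure: "\<And>a b. P (a \<otimes> b)" and add: "\<And>x y. P x \<Longrightarrow> P y \<Longrightarrow> P (x + y)"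
  shows "P t"
proof -
  have "P (abs_tensor p)" for p
  proof (induction p rule: poly_mapping_induct)
    case (single k v)
    obtain a b where k: "k = (a, b)" by (cases k)
    have "Poly_Mapping.single k v = v *\<^sub>C Poly_Mapping.single (a, b) 1"
      by (rule poly_mapping_eqI) (simp add: k lookup_single when_def)
    then have "abs_tensor (Poly_Mapping.single k v) = v *\<^sub>C (a \<otimes> b)"
      by (simp add: pure_tensor.abs_eq scaleC_tensor.abs_eq)
    also have "\<dots> = (v *\<^sub>C a) \<otimes> b"
      by (simp add: pure_tensor_linear)
    finally show ?case by (simp add: pure)
  next
    case (sum f g)
    then show ?case using add by (simp flip: plus_tensor.abs_eq)
  qed
  then show ?thesis by (metis Quotient_tensor Quotient_abs_rep)
qed

definition lin_ext :: "('k \<Rightarrow> 'c::complex_vector) \<Rightarrow> ('k \<Rightarrow>\<^sub>0 complex) \<Rightarrow> 'c"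
  where "lin_ext f p = (\<Sum>k\<in>Poly_Mapping.keys p. Poly_Mapping.lookup p k *\<^sub>C f k)"

lemma lin_ext_superset:
  "finite K \<Longrightarrow> Poly_Mapping.keys p \<subseteq> K \<Longrightarrow> lin_ext f p = (\<Sum>k\<in>K. Poly_Mapping.lookup p k *\<^sub>C f k)"
  unfolding lin_ext_def by (rule sum.mono_neutral_left) (auto simp: in_keys_iff)

lemma clinear_lin_ext: "clinear (lin_ext f)"
proof (rule clinearI)
  fix p q :: "'a \<Rightarrow>\<^sub>0 complex" and c
  let ?K = "Poly_Mapping.keys p \<union> Poly_Mapping.keys q"
  have "lin_ext f (p + q) = (\<Sum>k\<in>?K. Poly_Mapping.lookup (p + q) k *\<^sub>C f k)"
    by (rule lin_ext_superset) (simp_all add: keys_add)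
  also have "\<dots> = lin_ext f p + lin_ext f q"
    by (simp add: lin_ext_superset [of ?K] lookup_add scaleC_add_left sum.distrib)
  finally show "lin_ext f (p + q) = lin_ext f p + lin_ext f q" .
  have "lin_ext f (c *\<^sub>C p) = (\<Sum>k\<in>Poly_Mapping.keys p. Poly_Mapping.lookup (c *\<^sub>C p) k *\<^sub>C f k)"
    by (rule lin_ext_superset) (auto simp: in_keys_iff)
  then show "lin_ext f (c *\<^sub>C p) = c *\<^sub>C lin_ext f p"
    by (simp add: lin_ext_def cvec.scale_sum_right)
qed

lemma lin_ext_single [simp]: "lin_ext f (Poly_Mapping.single k c) = c *\<^sub>C f k"
  by (simp add: lin_ext_def)

text \<open>The linear map induced by a bilinear map; for \<open>f\<close> that is not bilinear the value depends on
  the chosen representative and is meaningless.\<close>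

definition tensor_lift ::
  "('a::complex_vector \<Rightarrow> 'b::complex_vector \<Rightarrow> 'c::complex_vector) \<Rightarrow> ('a, 'b) tensor \<Rightarrow> 'c"
  where "tensor_lift f t = lin_ext (\<lambda>(a, b). f a b) (rep_tensor t)"

lemma tensor_lift_abs:
  assumes "cbilinear f"
  shows "tensor_lift f (abs_tensor p) = lin_ext (\<lambda>(a, b). f a b) p"
proof -
  let ?F = "lin_ext (\<lambda>(a, b). f a b)"
  interpret F: Vector_Spaces.linear scaleC scaleC ?F by (rule clinear_lin_ext)
  have "tensor_relations \<subseteq> {p. ?F p = 0}"
    using assms
    by (auto simp: tensor_relations_def Let_def F.diff F.add F.scale cbilinear_def clinear_iff
        scaleC_one)
  then have "cvec.span tensor_relations \<subseteq> {p. ?F p = 0}"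
    by (rule cvec.span_minimal) (rule F.subspace_kernel)
  moreover have "tensor_rel (rep_tensor (abs_tensor p)) p"
    using Quotient_tensor by (metis Quotient_rep_abs tensor_equivp equivp_reflp)
  ultimately have "?F (rep_tensor (abs_tensor p) - p) = 0"
    by (auto simp: tensor_rel_def)
  then show ?thesis by (simp add: tensor_lift_def F.diff)
qed

lemma tensor_lift_pure: "cbilinear f \<Longrightarrow> tensor_lift f (a \<otimes> b) = f a b"
  by (simp add: pure_tensor.abs_eq tensor_lift_abs scaleC_one)

lemma clinear_tensor_lift:
  assumes "cbilinear f"
  shows "clinear (tensor_lift f)"
proof (rule clinearI)
  interpret F: Vector_Spaces.linear scaleC scaleC "lin_ext (\<lambda>(a, b). f a b)"
    by (rule clinear_lin_ext)
  fix x y :: "('a, 'b) tensor" and c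
  obtain p q where "x = abs_tensor p" "y = abs_tensor q"
    by (metis Quotient_tensor Quotient_abs_rep)
  then show "tensor_lift f (x + y) = tensor_lift f x + tensor_lift f y"
    and "tensor_lift f (c *\<^sub>C x) = c *\<^sub>C tensor_lift f x"
    by (simp_all add: plus_tensor.abs_eq scaleC_tensor.abs_eq tensor_lift_abs [OF assms] F.add
        F.scale)
qed

definition tensor_mult ::
  "('a::complex_algebra_1, 'b::complex_algebra_1) tensor \<Rightarrow> ('a, 'b) tensor \<Rightarrow> ('a, 'b) tensor"
  where "tensor_mult x y =
    tensor_lift (\<lambda>a b. tensor_lift (\<lambda>a' b'. (a * a') \<otimes> (b * b')) y) x"

context
begin

private lemma bil: "cbilinear (\<lambda>a' b'. (a * a') \<otimes> (b * b'))"
  for a :: "'a::complex_algebra_1" and b :: "'b::complex_algebra_1"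
  by (simp add: cbilinear_def clinear_iff pure_tensor_linear distrib_left mult_scaleC_right)

private lemma bil_out:
  "cbilinear (\<lambda>a b. tensor_lift (\<lambda>a' b'. (a * a') \<otimes> (b * b')) y)"
  for y :: "('a::complex_algebra_1, 'b::complex_algebra_1) tensor"
proof (induction y rule: tensor_induct)
  case (pure c d)
  then show ?case
    by (simp add: tensor_lift_pure [OF bil] cbilinear_def clinear_iff pure_tensor_linear
        distrib_right mult_scaleC_left)
next
  case (add x y)
  then show ?case
    by (simp add: clinear_tensor_lift [OF bil, unfolded clinear_iff] cbilinear_def clinear_iff
        scaleC_add_right algebra_simps)
qed

lemma tensor_mult_pure: "tensor_mult (a \<otimes> b) (c \<otimes> d) = (a * c) \<otimes> (b * d)"
proof -
  have "tensor_mult (a \<otimes> b) (c \<otimes> d) = tensor_lift (\<lambda>a' b'. (a * a') \<otimes> (b * b')) (c \<otimes> d)"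
    unfolding tensor_mult_def by (rule tensor_lift_pure [OF bil_out])
  then show ?thesis by (simp add: tensor_lift_pure [OF bil])
qed

lemma tensor_mult_left: "clinear (\<lambda>x. tensor_mult x y)"
  unfolding tensor_mult_def by (rule clinear_tensor_lift [OF bil_out])

lemma tensor_mult_right: "clinear (tensor_mult x)"
proof (induction x rule: tensor_induct)
  case (pure a b)
  have "tensor_mult (a \<otimes> b) = tensor_lift (\<lambda>a' b'. (a * a') \<otimes> (b * b'))"
    by (simp add: fun_eq_iff tensor_mult_def tensor_lift_pure [OF bil_out])
  then show ?case by (simp add: clinear_tensor_lift [OF bil])
next
  case (add x y)
  then show ?case
    by (simp add: clinear_iff tensor_mult_left [unfolded clinear_iff] scaleC_add_right
        algebra_simps)
qed

end

instantiation tensor :: (complex_algebra_1, complex_algebra_1) complex_algebra_1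
begin
definition one_tensor :: "('a, 'b) tensor" where "1 = 1 \<otimes> 1"
definition times_tensor :: "('a, 'b) tensor \<Rightarrow> ('a, 'b) tensor \<Rightarrow> ('a, 'b) tensor"
  where "x * y = tensor_mult x y"
instance
proof
  fix x y z :: "('a, 'b) tensor" and c
  note L = tensor_mult_left [unfolded clinear_iff] and R = tensor_mult_right [unfolded clinear_iff]
  show "(x + y) * z = x * z + y * z" by (simp add: times_tensor_def L)
  show "x * (y + z) = x * y + x * z" by (simp add: times_tensor_def R)
  show "(c *\<^sub>C x) * y = c *\<^sub>C (x * y)" by (simp add: times_tensor_def L)
  show "x * (c *\<^sub>C y) = c *\<^sub>C (x * y)" by (simp add: times_tensor_def R)
  show "1 * x = x" unfolding times_tensor_def one_tensor_def
    by (induction x rule: tensor_induct) (simp_all add: tensor_mult_pure R)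
  show "x * 1 = x" unfolding times_tensor_def one_tensor_def
    by (induction x rule: tensor_induct) (simp_all add: tensor_mult_pure L)
  show "x * y * z = x * (y * z)" unfolding times_tensor_def
  proof (induction x rule: tensor_induct)
    case (pure a b)
    show ?case
    proof (induction y rule: tensor_induct)
      case (pure c d)
      show ?case
        by (induction z rule: tensor_induct) (simp_all add: tensor_mult_pure R mult.assoc)
    qed (simp add: L R)
  qed (simp add: L)
qed
end

lemma pure_tensor_mult: "(a \<otimes> b) * (c \<otimes> d) = (a * c) \<otimes> (b * d)"
  by (simp add: times_tensor_def tensor_mult_pure)


section \<open>The classical Yang--Baxter equation\<close>

type_synonym 'a uea3 = "('a uea, ('a uea, 'a uea) tensor) tensor"

definition leg12 :: "('a::complex_lie_algebra, 'a) tensor \<Rightarrow> 'a uea3"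
  where "leg12 = tensor_lift (\<lambda>a b. uea_incl a \<otimes> uea_incl b \<otimes> 1)"

definition leg13 :: "('a::complex_lie_algebra, 'a) tensor \<Rightarrow> 'a uea3"
  where "leg13 = tensor_lift (\<lambda>a b. uea_incl a \<otimes> 1 \<otimes> uea_incl b)"

definition leg23 :: "('a::complex_lie_algebra, 'a) tensor \<Rightarrow> 'a uea3"
  where "leg23 = tensor_lift (\<lambda>a b. 1 \<otimes> uea_incl a \<otimes> uea_incl b)"

lemma cbilinear_legs:
  fixes dummy :: "'a::complex_lie_algebra"
  shows "cbilinear (\<lambda>a b :: 'a. uea_incl a \<otimes> uea_incl b \<otimes> (1 :: 'a uea))"
    and "cbilinear (\<lambda>a b :: 'a. uea_incl a \<otimes> (1 :: 'a uea) \<otimes> uea_incl b)"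
    and "cbilinear (\<lambda>a b :: 'a. (1 :: 'a uea) \<otimes> uea_incl a \<otimes> uea_incl b)"
  by (simp_all add: cbilinear_def clinear_iff uea_incl_add uea_incl_scaleC pure_tensor_linear)

lemma leg_pure:
  "leg12 (a \<otimes> b) = uea_incl a \<otimes> uea_incl b \<otimes> 1"
  "leg13 (a \<otimes> b) = uea_incl a \<otimes> 1 \<otimes> uea_incl b"
  "leg23 (a \<otimes> b) = 1 \<otimes> uea_incl a \<otimes> uea_incl b"
  by (simp_all add: leg12_def leg13_def leg23_def tensor_lift_pure cbilinear_legs)

lemma clinear_leg: "clinear leg12" "clinear leg13" "clinear leg23"
  unfolding leg12_def leg13_def leg23_def by (simp_all add: clinear_tensor_lift cbilinear_legs)

definition cybe_solution :: "('a::complex_lie_algebra, 'a) tensor \<Rightarrow> bool"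
  where "cybe_solution r \<longleftrightarrow>
    commutator (leg12 r) (leg13 r) + commutator (leg12 r) (leg23 r)
      + commutator (leg13 r) (leg23 r) = 0"


section \<open>The Lie algebra \<open>\<gg>(D\<^sub>1\<^sub>2)\<close>\<close>

text \<open>A realisation as the commutator Lie algebra of the associative algebra with
  \<open>e\<^sub>3 \<cdot> e\<^sub>1 = e\<^sub>1\<close>, \<open>e\<^sub>2 \<cdot> e\<^sub>3 = e\<^sub>2\<close>, \<open>e\<^sub>3 \<cdot> e\<^sub>3 = e\<^sub>3\<close> and the other products zero. It
  shows that the assumptions by which \<open>\<gg>(D\<^sub>1\<^sub>2)\<close> is characterised later are satisfiable.\<close>

datatype d12 = D12 complex complex complex

fun d12_mult :: "d12 \<Rightarrow> d12 \<Rightarrow> d12"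
  where "d12_mult (D12 x1 x2 x3) (D12 y1 y2 y3) = D12 (x3 * y1) (x2 * y3) (x3 * y3)"

instantiation d12 :: complex_lie_algebra
begin
definition "0 = D12 0 0 0"
fun plus_d12 where "D12 x1 x2 x3 + D12 y1 y2 y3 = D12 (x1 + y1) (x2 + y2) (x3 + y3)"
fun minus_d12 where "D12 x1 x2 x3 - D12 y1 y2 y3 = D12 (x1 - y1) (x2 - y2) (x3 - y3)"
fun uminus_d12 where "- D12 x1 x2 x3 = D12 (- x1) (- x2) (- x3)"
fun scaleC_d12 where "c *\<^sub>C D12 x1 x2 x3 = D12 (c * x1) (c * x2) (c * x3)"
definition lie_bracket_d12 :: "d12 \<Rightarrow> d12 \<Rightarrow> d12"
  where "lie_bracket_d12 x y = d12_mult x y - d12_mult y x"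
instance
proof
  fix x y z :: d12 and c d :: complex
  obtain x1 x2 x3 y1 y2 y3 z1 z2 z3
    where [simp]: "x = D12 x1 x2 x3" "y = D12 y1 y2 y3" "z = D12 z1 z2 z3"
    by (cases x, cases y, cases z) blast
  show "x + y + z = x + (y + z)" "x + y = y + x" "0 + x = x" "- x + x = 0" "x - y = x + - y"
    "c *\<^sub>C (x + y) = c *\<^sub>C x + c *\<^sub>C y" "(c + d) *\<^sub>C x = c *\<^sub>C x + d *\<^sub>C x"
    "c *\<^sub>C d *\<^sub>C x = (c * d) *\<^sub>C x" "1 *\<^sub>C x = x"
    "lie_bracket (x + y) z = lie_bracket x z + lie_bracket y z"
    "lie_bracket x (y + z) = lie_bracket x y + lie_bracket x z"
    "lie_bracket (c *\<^sub>C x) y = c *\<^sub>C lie_bracket x y"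
    "lie_bracket x (c *\<^sub>C y) = c *\<^sub>C lie_bracket x y"
    "lie_bracket x x = 0"
    "lie_bracket x (lie_bracket y z) + lie_bracket y (lie_bracket z x)
      + lie_bracket z (lie_bracket x y) = 0"
    by (simp_all add: zero_d12_def lie_bracket_d12_def algebra_simps)
qed
end

lemma d12_realisation:
  fixes e1 e2 e3 :: d12
  defines "e1 \<equiv> D12 1 0 0" and "e2 \<equiv> D12 0 1 0" and "e3 \<equiv> D12 0 0 1"
  shows "basis_list [e1, e2, e3]"
    and "lie_bracket e1 e2 = 0" "lie_bracket e1 e3 = - e1" "lie_bracket e2 e3 = e2"
proof -
  have in_span: "D12 a b c \<in> cvec.span {e1, e2, e3}" for a b c
  proof -
    have "a *\<^sub>C e1 + b *\<^sub>C e2 + c *\<^sub>C e3 \<in> cvec.span {e1, e2, e3}"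
      by (intro cvec.span_add cvec.span_scale cvec.span_base) auto
    then show ?thesis by (simp add: e1_def e2_def e3_def)
  qed
  have "cvec.span {e1, e2, e3} = UNIV"
    using in_span by (metis UNIV_eq_I d12.exhaust)
  moreover have "cvec.independent {e1, e2, e3}"
  proof -
    have nz: "e3 \<noteq> 0" by (simp add: e3_def zero_d12_def)
    have s3: "e2 \<notin> cvec.span {e3}"
      by (auto simp: cvec.span_singleton e2_def e3_def)
    have "cvec.span {e2, e3} \<subseteq> {x. \<exists>b c. x = D12 0 b c}"
    proof (rule cvec.span_minimal)
      show "{e2, e3} \<subseteq> {x. \<exists>b c. x = D12 0 b c}"
        by (auto simp: e2_def e3_def)
      show "cvec.subspace {x. \<exists>b c. x = D12 0 b c}"
        by (auto simp: cvec.subspace_def zero_d12_def)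
    qed
    then have s23: "e1 \<notin> cvec.span {e2, e3}" by (auto simp: e1_def)
    show ?thesis
      using nz s3 s23 by (simp add: cvec.independent_insert)
  qed
  ultimately show "basis_list [e1, e2, e3]"
    by (simp add: basis_list_def) (simp add: e1_def e2_def e3_def)
  show "lie_bracket e1 e2 = 0" "lie_bracket e1 e3 = - e1" "lie_bracket e2 e3 = e2"
    by (simp_all add: lie_bracket_d12_def e1_def e2_def e3_def zero_d12_def)
qed

end

theory Submission
  imports Defs
begin

text \<open>The element \<open>e\<^sub>3\<^sup>*\<close> is central in the semidirect product, and in \<open>r\<^sub>4\<close> and \<open>r\<^sub>5\<close> the
  vector \<open>v\<close> is a multiple of \<open>u\<close>. Hence each of the five tensors has the form
  \<open>u \<otimes> w - w \<otimes> u\<close> with \<open>u\<close> in \<open>\<gg>\<close>, \<open>w\<close> in \<open>\<gg>\<^sup>*\<close>, and in each case \<open>[u, w]\<close> is a multiple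
  of \<open>w\<close>. For such a tensor the left-hand side of the Yang--Baxter equation is, up to a scalar,
  \<open>u \<and> w \<and> [u, w]\<close>, which vanishes.\<close>

section \<open>Zero, sign and difference rules for brackets and tensors\<close>

lemma lie_zero [simp]: "lie_bracket 0 x = 0" "lie_bracket x 0 = 0"
  for x :: "'a::complex_lie_algebra"
  using lie_scaleC_left [of 0 0 x] lie_scaleC_right [of x 0 0] by simp_all

lemma lie_minus:
  "lie_bracket (- x) y = - lie_bracket x y" "lie_bracket x (- y) = - lie_bracket x y"
  for x y :: "'a::complex_lie_algebra"
  using lie_scaleC_left [of "- 1" x y] lie_scaleC_right [of x "- 1" y] by simp_all

lemma lie_diff:
  "lie_bracket (x - y) z = lie_bracket x z - lie_bracket y z"
  "lie_bracket z (x - y) = lie_bracket z x - lie_bracket z y"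
  for x y z :: "'a::complex_lie_algebra"
  using lie_add_left [of x "- y" z] lie_add_right [of z x "- y"] by (simp_all add: lie_minus)

lemma pure_tensor_zero [simp]: "0 \<otimes> b = 0" "a \<otimes> 0 = 0"
  using pure_tensor_linear(3) [of 0 0 b] pure_tensor_linear(4) [of a 0 0] by simp_all

lemma pure_tensor_minus: "(- a) \<otimes> b = - (a \<otimes> b)" "a \<otimes> (- b) = - (a \<otimes> b)"
  using pure_tensor_linear(3) [of "- 1" a b] pure_tensor_linear(4) [of a "- 1" b] by simp_all

lemma pure_tensor_diff:
  "(a - a') \<otimes> b = a \<otimes> b - a' \<otimes> b" "a \<otimes> (b - b') = a \<otimes> b - a \<otimes> b'"
  using pure_tensor_linear(1) [of a "- a'" b] pure_tensor_linear(2) [of a b "- b'"]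
  by (simp_all add: pure_tensor_minus)

text \<open>The functional \<open>f i\<close> vanishes on every other vector of the list, hence on
  their span, but takes the value 1 at \<open>bs ! i\<close>. So no vector lies in the span of the
  others, and equal vectors at two positions would force 0 = 1.\<close>

lemma basis_list_biorthogonal:
  fixes f :: "nat \<Rightarrow> 'a::complex_vector \<Rightarrow> complex"
  assumes lin: "\<And>i. i < length bs \<Longrightarrow> clinear (f i)"
    and f: "\<And>i j. i < length bs \<Longrightarrow> j < length bs \<Longrightarrow> f i (bs ! j) = (if i = j then 1 else 0)"
    and span: "\<And>x. x \<in> cvec.span (set bs)"
  shows "basis_list bs"
proof -
  have "distinct bs"
    unfolding distinct_conv_nth using f by (metis zero_neq_one)
  moreover have "cvec.independent (set bs)"
    unfolding cvec.dependent_def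
  proof
    assume "\<exists>a\<in>set bs. a \<in> cvec.span (set bs - {a})"
    then obtain i where i: "i < length bs" and *: "bs ! i \<in> cvec.span (set bs - {bs ! i})"
      by (metis in_set_conv_nth)
    interpret L: Vector_Spaces.linear scaleC scaleC "f i" by (rule lin [OF i])
    have "set bs - {bs ! i} \<subseteq> {x. f i x = 0}"
      using f i by (force simp: in_set_conv_nth)
    then have "cvec.span (set bs - {bs ! i}) \<subseteq> {x. f i x = 0}"
      by (rule cvec.span_minimal) (rule L.subspace_kernel)
    with * f [OF i i] show False by auto
  qed
  ultimately show ?thesis using span by (auto simp: basis_list_def)
qed

section \<open>Functionals and the dual basis\<close>

lemma dual_apply_linear: "clinear (dual_apply \<xi>)"
  using dual_apply [of \<xi>] by simp

lemma dual_apply_simps [simp]: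
  "dual_apply (\<xi> + \<eta>) x = dual_apply \<xi> x + dual_apply \<eta> x"
  "dual_apply (c *\<^sub>C \<xi>) x = c * dual_apply \<xi> x"
  "dual_apply (- \<xi>) x = - dual_apply \<xi> x"
  "dual_apply 0 x = 0"
  by (simp_all add: plus_dual.rep_eq scaleC_dual.rep_eq uminus_dual.rep_eq zero_dual.rep_eq)

lemma dual_apply_linear_simps [simp]:
  "dual_apply \<xi> (x + y) = dual_apply \<xi> x + dual_apply \<xi> y"
  "dual_apply \<xi> (c *\<^sub>C x) = c * dual_apply \<xi> x"
  "dual_apply \<xi> (- x) = - dual_apply \<xi> x"
  "dual_apply \<xi> 0 = 0"
proof -
  interpret Vector_Spaces.linear scaleC scaleC "dual_apply \<xi>" by (rule dual_apply_linear)
  show "dual_apply \<xi> (x + y) = dual_apply \<xi> x + dual_apply \<xi> y"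
    "dual_apply \<xi> (c *\<^sub>C x) = c * dual_apply \<xi> x"
    "dual_apply \<xi> (- x) = - dual_apply \<xi> x" "dual_apply \<xi> 0 = 0"
    by (simp_all add: add scale neg)
qed

lemma dual_apply_sum: "dual_apply (sum g A) x = (\<Sum>a\<in>A. dual_apply (g a) x)"
  by (induction A rule: infinite_finite_induct) simp_all

lemma dual_eq_on_basis:
  assumes "basis_list bs" and eq: "\<And>b. b \<in> set bs \<Longrightarrow> dual_apply \<xi> b = dual_apply \<eta> b"
  shows "\<xi> = \<eta>"
proof -
  have span: "x \<in> cvec.span (set bs)" for x using assms(1) by (simp add: basis_list_def)
  have "dual_apply \<xi> x = dual_apply \<eta> x" for x
    using span [of x] by (induction rule: cvec.span_induct_alt) (simp_all add: eq)
  then show ?thesis by (simp add: fun_eq_iff flip: dual_apply_inject)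
qed

lemma dual_basis_span:
  assumes "basis_list bs" "dual_basis_of bs ds"
  shows "\<xi> \<in> cvec.span (set ds)"
proof -
  have len: "length ds = length bs"
    and d: "\<And>i j. i < length bs \<Longrightarrow> j < length bs \<Longrightarrow>
      dual_apply (ds ! i) (bs ! j) = (if i = j then 1 else 0)"
    using assms(2) by (auto simp: dual_basis_of_def)
  \<comment> \<open>The coordinates of a functional in the dual basis are its values on the basis;
    both sides agree at each \<open>bs ! j\<close>.\<close>
  have "\<xi> = (\<Sum>i<length bs. dual_apply \<xi> (bs ! i) *\<^sub>C (ds ! i))"
    by (rule dual_eq_on_basis [OF assms(1)])
      (auto simp: in_set_conv_nth dual_apply_sum d if_distrib [of "\<lambda>z. _ * z"] cong: if_cong)
  also have "\<dots> \<in> cvec.span (set ds)"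
    by (intro cvec.span_sum cvec.span_scale cvec.span_base) (simp add: len)
  finally show ?thesis .
qed

section \<open>The coadjoint semidirect product\<close>

lemma in_alg_linear: "clinear in_alg"
  by (rule clinearI; transfer) simp_all

lemma in_dual_linear: "clinear in_dual"
  by (rule clinearI; transfer) simp_all

lemma in_dual_minus_zero:
  "in_dual (- \<xi>) = - in_dual \<xi>" "in_dual 0 = 0"
  by (transfer; simp add: zero_prod_def)+

lemma in_alg_minus_zero:
  "in_alg (- x) = - in_alg x" "in_alg 0 = 0"
  by (transfer; simp add: zero_prod_def)+

lemma coad_zero: "coad 0 \<xi> = 0" "coad x 0 = 0"
  using coad_linear(2) [of 0 0 \<xi>] coad_linear(4) [of x 0 0] by simp_all

lemma lie_bracket_in:
  "lie_bracket (in_alg x) (in_alg y) = in_alg (lie_bracket x y)"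
  "lie_bracket (in_alg x) (in_dual \<xi>) = in_dual (coad x \<xi>)"
  "lie_bracket (in_dual \<xi>) (in_dual \<eta>) = 0"
  by (transfer; simp add: coad_zero zero_prod_def)+

lemma semidirect_decompose: "\<exists>x \<xi>. z = in_alg x + in_dual \<xi>"
  by transfer auto

lemma basis_list_coad_semidirect:
  fixes bs :: "'a::complex_lie_algebra list"
  assumes bs: "basis_list bs" and ds: "dual_basis_of bs ds"
  shows "basis_list (map in_alg bs @ map in_dual ds)"
proof -
  let ?n = "length bs"
  let ?R = Rep_coad_semidirect
  let ?S = "set (map in_alg bs @ map in_dual ds)"
  \<comment> \<open>Coordinate functionals: an element of the algebra summand is measured by the
    dual basis, an element of the dual summand by evaluation at the basis. The index shift
    \<open>i - ?n\<close> matches the concatenated list.\<close>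
  define f where "f = (\<lambda>i z. if i < ?n then dual_apply (ds ! i) (fst (?R z))
    else dual_apply (snd (?R z)) (bs ! (i - ?n)))"
  have len: "length ds = ?n"
    and d: "\<And>i j. i < ?n \<Longrightarrow> j < ?n \<Longrightarrow> dual_apply (ds ! i) (bs ! j) = (if i = j then 1 else 0)"
    using ds by (auto simp: dual_basis_of_def)
  show ?thesis
  proof (rule basis_list_biorthogonal [where f = f])
    fix i
    have "?R (c *\<^sub>C z) = (c *\<^sub>C fst (?R z), c *\<^sub>C snd (?R z))" for c and z :: "'a coad_semidirect"
      by (simp add: scaleC_coad_semidirect.rep_eq case_prod_beta)
    then show "clinear (f i)"
      by (intro clinearI) (simp_all add: f_def plus_coad_semidirect.rep_eq)
  next
    fix i j
    assume "i < length (map in_alg bs @ map in_dual ds)" "j < length (map in_alg bs @ map in_dual ds)"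
    then show "f i ((map in_alg bs @ map in_dual ds) ! j) = (if i = j then 1 else 0)"
      by (auto simp: f_def nth_append len d in_alg.rep_eq in_dual.rep_eq)
  next
    fix z :: "'a coad_semidirect"
    obtain x \<xi> where z: "z = in_alg x + in_dual \<xi>" using semidirect_decompose by blast
    interpret A: Vector_Spaces.linear scaleC scaleC in_alg by (rule in_alg_linear)
    interpret D: Vector_Spaces.linear scaleC scaleC in_dual by (rule in_dual_linear)
    \<comment> \<open>A linear map sends a span to the span of the image, so each embedded basis
      spans its whole summand.\<close>
    have "in_alg x \<in> cvec.span (in_alg ` set bs)"
      using bs by (simp add: A.span_image basis_list_def)
    moreover have "in_dual \<xi> \<in> cvec.span (in_dual ` set ds)"
      using dual_basis_span [OF bs ds] by (simp add: D.span_image)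
    ultimately show "z \<in> cvec.span ?S"
      unfolding z
      by (intro cvec.span_add) (erule cvec.span_mono [THEN subsetD, rotated]; auto)+
  qed
qed

section \<open>The Yang-Baxter equation for skew-symmetric tensors\<close>

lemma commutator_pure:
  fixes a b c d :: "'a::complex_lie_algebra"
  shows "commutator (leg12 (a \<otimes> b)) (leg13 (c \<otimes> d))
      = uea_incl (lie_bracket a c) \<otimes> uea_incl b \<otimes> uea_incl d"
    and "commutator (leg12 (a \<otimes> b)) (leg23 (c \<otimes> d))
      = uea_incl a \<otimes> uea_incl (lie_bracket b c) \<otimes> uea_incl d"
    and "commutator (leg13 (a \<otimes> b)) (leg23 (c \<otimes> d))
      = uea_incl a \<otimes> uea_incl c \<otimes> uea_incl (lie_bracket b d)"
  \<comment> \<open>Two different legs overlap in exactly one tensor factor. In the other two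
    factors one entry is 1, so the commutator is concentrated in the shared factor and becomes a Lie
    bracket there.\<close>
  by (simp_all add: commutator_def leg_pure pure_tensor_mult pure_tensor_diff
      flip: uea_incl_lie)

lemma commutator_diff:
  "commutator (x - y) z = commutator x z - commutator y z"
  "commutator z (x - y) = commutator z x - commutator z y"
  by (simp_all add: commutator_def algebra_simps)

lemma leg_diff:
  "leg12 (x - y) = leg12 x - leg12 y" "leg13 (x - y) = leg13 x - leg13 y"
  "leg23 (x - y) = leg23 x - leg23 y"
  by (simp_all add: clinear_leg [THEN Vector_Spaces.linear.axioms(3),
        THEN module_hom.diff])

lemma uea_incl_zero [simp]: "uea_incl 0 = 0"
  using uea_incl_scaleC [of 0 0] by simp

lemma uea_incl_minus: "uea_incl (- x) = - uea_incl x"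
  using uea_incl_scaleC [of "- 1" x] by simp

text \<open>Bilinear expansion gives twelve terms. Six contain [u, u] or [w, w] and vanish; in the
  other six the hypothesis leaves c times w \<otimes> w \<otimes> u, w \<otimes> u \<otimes> w and u
  \<otimes> w \<otimes> w, each occurring once with either sign.\<close>

lemma cybe_solution_skew:
  fixes u w :: "'a::complex_lie_algebra"
  assumes uw: "lie_bracket u w = c *\<^sub>C w"
  shows "cybe_solution (u \<otimes> w - w \<otimes> u)"
proof -
  have wu: "lie_bracket w u = - c *\<^sub>C w"
    using uw by (simp add: lie_skew [of w u])
  show ?thesis
    by (simp add: cybe_solution_def leg_diff commutator_diff commutator_pure uw wu lie_self
        uea_incl_scaleC uea_incl_minus pure_tensor_linear pure_tensor_minus)
qed

theorem proposition5p20: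
  fixes e1 e2 e3 :: "'g::complex_lie_algebra" and \<epsilon>1 \<epsilon>2 \<epsilon>3 :: "'g dual"
    and E1 E2 E3 D1 D2 D3 :: "'g coad_semidirect"
  assumes basis: "basis_list [e1, e2, e3]"
    and brackets: "lie_bracket e1 e2 = 0" "lie_bracket e1 e3 = - e1" "lie_bracket e2 e3 = e2"
    and dual: "dual_basis_of [e1, e2, e3] [\<epsilon>1, \<epsilon>2, \<epsilon>3]"
    and embed: "E1 = in_alg e1" "E2 = in_alg e2" "E3 = in_alg e3"
    and embed_dual: "D1 = in_dual \<epsilon>1" "D2 = in_dual \<epsilon>2" "D3 = in_dual \<epsilon>3"
  shows
    "(basis_list [E1, E2, E3, D1, D2, D3] \<and>
      lie_bracket E1 E3 = - E1 \<and> lie_bracket E1 D1 = D3 \<and> lie_bracket E2 E3 = E2 \<and>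
      lie_bracket E2 D2 = - D3 \<and> lie_bracket E3 D1 = - D1 \<and> lie_bracket E3 D2 = D2 \<and>
      lie_bracket E1 E2 = 0 \<and> lie_bracket E1 D2 = 0 \<and> lie_bracket E1 D3 = 0 \<and>
      lie_bracket E2 D1 = 0 \<and> lie_bracket E2 D3 = 0 \<and> lie_bracket E3 D3 = 0 \<and>
      lie_bracket D1 D2 = 0 \<and> lie_bracket D1 D3 = 0 \<and> lie_bracket D2 D3 = 0)
    \<and> (\<forall>n31 n32. cybe_solution
        ((n31 *\<^sub>C E1 + n32 *\<^sub>C E2) \<otimes> D3 - D3 \<otimes> (n31 *\<^sub>C E1 + n32 *\<^sub>C E2)))
    \<and> (\<forall>n21 n31. n21 \<noteq> 0 \<longrightarrow> cybe_solution
        ((n21 *\<^sub>C E1) \<otimes> D2 + (n31 *\<^sub>C E1) \<otimes> D3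
          - D2 \<otimes> (n21 *\<^sub>C E1) - D3 \<otimes> (n31 *\<^sub>C E1)))
    \<and> (\<forall>n12 n32. n12 \<noteq> 0 \<longrightarrow> cybe_solution
        ((n12 *\<^sub>C E2) \<otimes> D1 + (n32 *\<^sub>C E2) \<otimes> D3
          - D1 \<otimes> (n12 *\<^sub>C E2) - D3 \<otimes> (n32 *\<^sub>C E2)))
    \<and> (\<forall>n21 n23 n33. n23 \<noteq> 0 \<longrightarrow>
        (let u = n21 *\<^sub>C E1 - n33 *\<^sub>C E2 + n23 *\<^sub>C E3;
             v = (n21 * n33 / n23) *\<^sub>C E1 - (n33\<^sup>2 / n23) *\<^sub>C E2 + n33 *\<^sub>C E3
         in cybe_solution (u \<otimes> D2 + v \<otimes> D3 - D2 \<otimes> u - D3 \<otimes> v)))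
    \<and> (\<forall>n12 n13 n33. n13 \<noteq> 0 \<longrightarrow>
        (let u = (- n33) *\<^sub>C E1 + n12 *\<^sub>C E2 + n13 *\<^sub>C E3;
             v = (- (n33\<^sup>2 / n13)) *\<^sub>C E1 + (n12 * n33 / n13) *\<^sub>C E2 + n33 *\<^sub>C E3
         in cybe_solution (u \<otimes> D1 + v \<otimes> D3 - D1 \<otimes> u - D3 \<otimes> v)))"
proof -
  have d: "dual_apply \<epsilon>1 e1 = 1" "dual_apply \<epsilon>1 e2 = 0" "dual_apply \<epsilon>1 e3 = 0"
    "dual_apply \<epsilon>2 e1 = 0" "dual_apply \<epsilon>2 e2 = 1" "dual_apply \<epsilon>2 e3 = 0"
    "dual_apply \<epsilon>3 e1 = 0" "dual_apply \<epsilon>3 e2 = 0" "dual_apply \<epsilon>3 e3 = 1"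
    using dual by (simp_all add: dual_basis_of_def All_less_Suc)
  have skew: "lie_bracket e2 e1 = 0" "lie_bracket e3 e1 = e1" "lie_bracket e3 e2 = - e2"
    using brackets by (simp_all add: lie_skew [of e2 e1] lie_skew [of e3 e1] lie_skew [of e3 e2])
  have coad:
    "coad e1 \<epsilon>1 = \<epsilon>3" "coad e1 \<epsilon>2 = 0" "coad e1 \<epsilon>3 = 0"
    "coad e2 \<epsilon>1 = 0" "coad e2 \<epsilon>2 = - \<epsilon>3" "coad e2 \<epsilon>3 = 0"
    "coad e3 \<epsilon>1 = - \<epsilon>1" "coad e3 \<epsilon>2 = \<epsilon>2" "coad e3 \<epsilon>3 = 0"
    \<comment> \<open>Evaluation at \<open>e1\<close>, \<open>e2\<close>, \<open>e3\<close> turns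
      each identity into brackets of basis vectors, in both orders. For example, the value of
      \<open>coad e1 \<epsilon>1\<close> at \<open>e3\<close> is -\<epsilon>1([e1, e3]) =
      \<epsilon>1(e1) = 1.\<close>
    by (rule dual_eq_on_basis [OF basis];
        auto simp: coad.rep_eq brackets skew d lie_self)+
  have br: "lie_bracket E1 E3 = - E1" "lie_bracket E1 D1 = D3" "lie_bracket E2 E3 = E2"
    "lie_bracket E2 D2 = - D3" "lie_bracket E3 D1 = - D1" "lie_bracket E3 D2 = D2"
    "lie_bracket E1 E2 = 0" "lie_bracket E1 D2 = 0" "lie_bracket E1 D3 = 0"
    "lie_bracket E2 D1 = 0" "lie_bracket E2 D3 = 0" "lie_bracket E3 D3 = 0"
    "lie_bracket D1 D2 = 0" "lie_bracket D1 D3 = 0" "lie_bracket D2 D3 = 0"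
    by (simp_all add: embed embed_dual lie_bracket_in brackets coad in_alg_minus_zero
        in_dual_minus_zero)
  have basis6: "basis_list [E1, E2, E3, D1, D2, D3]"
    using basis_list_coad_semidirect [OF basis dual] by (simp add: embed embed_dual)
  note lie = lie_add_left lie_add_right lie_diff lie_minus lie_scaleC_left lie_scaleC_right br
  note tensor = pure_tensor_linear pure_tensor_diff pure_tensor_minus
  have r1: "cybe_solution ((n31 *\<^sub>C E1 + n32 *\<^sub>C E2) \<otimes> D3 - D3 \<otimes> (n31 *\<^sub>C E1 + n32 *\<^sub>C E2))"
    for n31 n32
    \<comment> \<open>Here w is the central element \<open>D3\<close>, so the bracket is
      zero.\<close>
    by (rule cybe_solution_skew [where c = 0]) (simp add: lie)
  have r2: "cybe_solution ((n21 *\<^sub>C E1) \<otimes> D2 + (n31 *\<^sub>C E1) \<otimes> D3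
      - D2 \<otimes> (n21 *\<^sub>C E1) - D3 \<otimes> (n31 *\<^sub>C E1))" for n21 n31
  proof -
    \<comment> \<open>Moving the scalars across the tensor sign leaves u = \<open>E1\<close>, which
      commutes with both \<open>D2\<close> and \<open>D3\<close>.\<close>
    have "cybe_solution (E1 \<otimes> (n21 *\<^sub>C D2 + n31 *\<^sub>C D3) - (n21 *\<^sub>C D2 + n31 *\<^sub>C D3) \<otimes> E1)"
      by (rule cybe_solution_skew [where c = 0]) (simp add: lie)
    then show ?thesis by (simp add: tensor algebra_simps)
  qed
  have r3: "cybe_solution ((n12 *\<^sub>C E2) \<otimes> D1 + (n32 *\<^sub>C E2) \<otimes> D3
      - D1 \<otimes> (n12 *\<^sub>C E2) - D3 \<otimes> (n32 *\<^sub>C E2))" for n12 n32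
  proof -
    \<comment> \<open>Likewise, \<open>E2\<close> commutes with both \<open>D1\<close> and
      \<open>D3\<close>.\<close>
    have "cybe_solution (E2 \<otimes> (n12 *\<^sub>C D1 + n32 *\<^sub>C D3) - (n12 *\<^sub>C D1 + n32 *\<^sub>C D3) \<otimes> E2)"
      by (rule cybe_solution_skew [where c = 0]) (simp add: lie)
    then show ?thesis by (simp add: tensor algebra_simps)
  qed
  \<comment> \<open>Since v = t u, the term v \<otimes> D3 equals u \<otimes> (t D3). Both summands
    thus merge into one skew tensor with second vector w + t D3.\<close>
  have multiple: "cybe_solution (u \<otimes> w + v \<otimes> D3 - w \<otimes> u - D3 \<otimes> v)"
    if v: "v = t *\<^sub>C u" and "lie_bracket u (w + t *\<^sub>C D3) = c *\<^sub>C (w + t *\<^sub>C D3)" for u v w t c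
    using cybe_solution_skew [OF that(2)] by (simp add: v tensor algebra_simps)
  have r4: "let u = n21 *\<^sub>C E1 - n33 *\<^sub>C E2 + n23 *\<^sub>C E3;
             v = (n21 * n33 / n23) *\<^sub>C E1 - (n33\<^sup>2 / n23) *\<^sub>C E2 + n33 *\<^sub>C E3
         in cybe_solution (u \<otimes> D2 + v \<otimes> D3 - D2 \<otimes> u - D3 \<otimes> v)"
    if "n23 \<noteq> 0" for n21 n23 n33
    unfolding Let_def
    \<comment> \<open>The last coordinates of v and u give t. The \<open>E2\<close> part of u
      contributes \<open>n33\<close> times \<open>D3\<close> and the \<open>E3\<close> part
      \<open>n23\<close> times \<open>D2\<close>, so [u, D2 + t D3] = n23 D2 + n33 D3 = n23 (D2 + t
      D3).\<close>
    by (rule multiple [where t = "n33 / n23" and c = n23])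
      (use that in \<open>simp_all add: lie scaleC_add_right scaleC_scaleC
        cvec.scale_right_diff_distrib power2_eq_square mult.commute\<close>)
  have r5: "let u = (- n33) *\<^sub>C E1 + n12 *\<^sub>C E2 + n13 *\<^sub>C E3;
             v = (- (n33\<^sup>2 / n13)) *\<^sub>C E1 + (n12 * n33 / n13) *\<^sub>C E2 + n33 *\<^sub>C E3
         in cybe_solution (u \<otimes> D1 + v \<otimes> D3 - D1 \<otimes> u - D3 \<otimes> v)"
    if "n13 \<noteq> 0" for n12 n13 n33
    unfolding Let_def
    \<comment> \<open>Here the \<open>E1\<close> part contributes -n33 D3 and the \<open>E3\<close>
      part -n13 D1, which is the reason for the negative c.\<close>
    by (rule multiple [where t = "n33 / n13" and c = "- n13"])
      (use that in \<open>simp_all add: lie scaleC_add_right scaleC_scaleC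
        cvec.scale_right_diff_distrib power2_eq_square mult.commute\<close>)
  show ?thesis
    using basis6 br r1 r2 r3 r4 r5 by blast
qed

end
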